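(* Let $A=A_1+A_2$ be the core-EP decomposition of $A\in\mathbb{C}_{n,n}$. Then there exists a unitary matrix $U\in\mathbb{C}_{n,n}$ such that $$A_1=U\begin{bmatrix}T&S\\0&0\end{bmatrix}U^\ast\quad\text{and}\quad A_2=U\begin{bmatrix}0&0\\0&N\end{bmatrix}U^\ast,$$ where both block matrices are partitioned conformally with square diagonal blocks, $T$ is non-singular, and $N$ is nilpotent.
   Context: $\mathbb{C}_{n,n}$ is the set of $n\times n$ complex matrices, $A^\ast$ is the conjugate transpose, $\mathrm{rk}$ is the rank. The index $\mathrm{Ind}(A)$ is $0$ if $A$ is non-singular, and otherwise is the smallest positive integer $k$ with $\mathrm{rk}(A^{k+1})=\mathrm{rk}(A^k)$. $\mathbb{C}_n^{\mathtt{CM}}=\{A\in\mathbb{C}_{n,n} : \mathrm{rk}(A^2)=\mathrm{rk}(A)\}$ (core-invertible matrices). For $A\in\mathbb{C}_{n,n}$ with $\mathrm{Ind}(A)=k$, the core-EP decomposition of $A$ is the decomposition $A=A_1+A_2$ (it exists and is unique) with (i) $A_1\in\mathbb{C}_n^{\mathtt{CM}}$; (ii) $A_2^k=0$ (read as $A_2=0$ when $k=0$); (iii) $A_1^\ast A_2=A_2A_1=0$. Blocks in partitioned matrices are allowed to be empty (of size $0$). *)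

theory Defs
  imports "Jordan_Normal_Form.DL_Rank" "Jordan_Normal_Form.Schur_Decomposition"
begin

text \<open>
  The conjugate transpose is \<^const>\<open>mat_adjoint\<close>, the rank of a matrix with n rows
  is \<^term>\<open>vec_space.rank n\<close>.
\<close>

definition unitary_mat :: "nat \<Rightarrow> complex mat \<Rightarrow> bool" where
  "unitary_mat n U \<longleftrightarrow>
     U \<in> carrier_mat n n \<and> mat_adjoint U * U = 1\<^sub>m n \<and> U * mat_adjoint U = 1\<^sub>m n"

definition nilpotent_mat :: "'a :: semiring_1 mat \<Rightarrow> bool" where
  "nilpotent_mat N \<longleftrightarrow>
     square_mat N \<and> (\<exists>m>0. N ^\<^sub>m m = 0\<^sub>m (dim_row N) (dim_row N))"

definition mat_Ind :: "nat \<Rightarrow> complex mat \<Rightarrow> nat" where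
  "mat_Ind n A =
     (if invertible_mat A then 0
      else LEAST k. k > 0 \<and> vec_space.rank n (A ^\<^sub>m (k + 1)) = vec_space.rank n (A ^\<^sub>m k))"

definition core_invertible_mats :: "nat \<Rightarrow> complex mat set" where
  "core_invertible_mats n =
     {A \<in> carrier_mat n n. vec_space.rank n (A ^\<^sub>m 2) = vec_space.rank n A}"

text \<open>
  The case distinction on the index is needed because the zeroth power of a matrix is the
  identity; for an index of 0 the nilpotent part is required to vanish.
\<close>

definition core_EP_decomposition ::
    "nat \<Rightarrow> complex mat \<Rightarrow> complex mat \<Rightarrow> complex mat \<Rightarrow> bool" where
  "core_EP_decomposition n A A1 A2 \<longleftrightarrow>
     A \<in> carrier_mat n n \<and> A1 \<in> carrier_mat n n \<and> A2 \<in> carrier_mat n n \<and>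
     A = A1 + A2 \<and>
     A1 \<in> core_invertible_mats n \<and>
     (if mat_Ind n A = 0 then A2 = 0\<^sub>m n n else A2 ^\<^sub>m mat_Ind n A = 0\<^sub>m n n) \<and>
     mat_adjoint A1 * A2 = 0\<^sub>m n n \<and> A2 * A1 = 0\<^sub>m n n"

end

theory Submission
  imports Defs
begin

text \<open>
  Equality of the ranks of \<open>A1\<close> and its square gives equal column spaces, so
  \<open>A1 = A1 * A1 * X\<close> for some \<open>X\<close>. Choose a unitary \<open>U\<close> for which the rows of
  \<open>U* A1 U\<close> vanish from an index \<open>r\<close> on, with \<open>r\<close> least possible. If the leading
  block \<open>T\<close> were singular, a left null vector of \<open>T\<close> would, by the factorization,
  also annihilate \<open>S\<close>; rotating it into the last coordinate of the leading block would make
  one more row vanish. Hence \<open>T\<close> is non-singular, and the two orthogonality relations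
  then force every block of \<open>U* A2 U\<close> to vanish except the last one.
\<close>

section \<open>Conjugate transposes and block matrices\<close>

lemma mat_adjoint_carrier [simp]:
  "A \<in> carrier_mat m n \<Longrightarrow> mat_adjoint A \<in> carrier_mat n m"
  by (auto simp: mat_adjoint_def)

lemma dim_mat_adjoint [simp]:
  "dim_row (mat_adjoint A) = dim_col A" "dim_col (mat_adjoint A) = dim_row A"
  by (auto simp: mat_adjoint_def)

lemma index_mat_adjoint [simp]:
  "i < dim_col A \<Longrightarrow> j < dim_row A \<Longrightarrow> mat_adjoint A $$ (i, j) = conjugate (A $$ (j, i))"
  by (auto simp: mat_adjoint_def mat_of_rows_index)

lemma mat_adjoint_adjoint [simp]: "mat_adjoint (mat_adjoint A) = A"
  by (rule eq_matI) auto

lemma mat_adjoint_mult: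
  assumes "A \<in> carrier_mat m n" "B \<in> carrier_mat n p"
  shows "mat_adjoint (A * B) = mat_adjoint B * mat_adjoint A"
  using assms
  by (intro eq_matI)
    (auto simp: scalar_prod_def sum_conjugate conjugate_dist_mul mult.commute intro!: sum.cong)

lemma mat_adjoint_mult_conj:
  assumes U: "U \<in> carrier_mat n n" and V: "V \<in> carrier_mat n n" and A: "A \<in> carrier_mat n n"
  shows "mat_adjoint (U * V) * A * (U * V) = mat_adjoint V * (mat_adjoint U * A * U) * V"
  using assms
  by (simp add: mat_adjoint_mult[OF U V] assoc_mult_mat[of _ n n _ n _ n]
      mult_carrier_mat[of _ n n _ n])

lemma mat_adjoint_one [simp]: "mat_adjoint (1\<^sub>m n :: complex mat) = 1\<^sub>m n"
  by (rule eq_matI) auto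

lemma mat_adjoint_zero [simp]: "mat_adjoint (0\<^sub>m m n) = 0\<^sub>m n m"
  by (rule eq_matI) auto

lemma mat_adjoint_four_block_mat:
  assumes "A \<in> carrier_mat nr1 nc1" "B \<in> carrier_mat nr1 nc2"
    "C \<in> carrier_mat nr2 nc1" "D \<in> carrier_mat nr2 nc2"
  shows "mat_adjoint (four_block_mat A B C D) =
    four_block_mat (mat_adjoint A) (mat_adjoint C) (mat_adjoint B) (mat_adjoint D)"
  using assms by (intro eq_matI) auto

lemma four_block_mat_eq_zeroD:
  assumes "A \<in> carrier_mat nr1 nc1" "B \<in> carrier_mat nr1 nc2"
    "C \<in> carrier_mat nr2 nc1" "D \<in> carrier_mat nr2 nc2"
    and zero: "four_block_mat A B C D = 0\<^sub>m (nr1 + nr2) (nc1 + nc2)"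
  shows "A = 0\<^sub>m nr1 nc1" "B = 0\<^sub>m nr1 nc2" "C = 0\<^sub>m nr2 nc1" "D = 0\<^sub>m nr2 nc2"
proof -
  have ij: "four_block_mat A B C D $$ (i, j) = 0" if "i < nr1 + nr2" "j < nc1 + nc2" for i j
    using that by (simp add: zero)
  show "A = 0\<^sub>m nr1 nc1"
  proof (rule eq_matI)
    fix i j assume "i < dim_row (0\<^sub>m nr1 nc1 :: 'a mat)" "j < dim_col (0\<^sub>m nr1 nc1 :: 'a mat)"
    then show "A $$ (i, j) = 0\<^sub>m nr1 nc1 $$ (i, j)" using ij[of i j] assms(1-4) by simp
  qed (use assms in auto)
  show "B = 0\<^sub>m nr1 nc2"
  proof (rule eq_matI)
    fix i j assume "i < dim_row (0\<^sub>m nr1 nc2 :: 'a mat)" "j < dim_col (0\<^sub>m nr1 nc2 :: 'a mat)"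
    then show "B $$ (i, j) = 0\<^sub>m nr1 nc2 $$ (i, j)" using ij[of i "nc1 + j"] assms(1-4) by simp
  qed (use assms in auto)
  show "C = 0\<^sub>m nr2 nc1"
  proof (rule eq_matI)
    fix i j assume "i < dim_row (0\<^sub>m nr2 nc1 :: 'a mat)" "j < dim_col (0\<^sub>m nr2 nc1 :: 'a mat)"
    then show "C $$ (i, j) = 0\<^sub>m nr2 nc1 $$ (i, j)" using ij[of "nr1 + i" j] assms(1-4) by simp
  qed (use assms in auto)
  show "D = 0\<^sub>m nr2 nc2"
  proof (rule eq_matI)
    fix i j assume "i < dim_row (0\<^sub>m nr2 nc2 :: 'a mat)" "j < dim_col (0\<^sub>m nr2 nc2 :: 'a mat)"
    then show "D $$ (i, j) = 0\<^sub>m nr2 nc2 $$ (i, j)" using ij[of "nr1 + i" "nc1 + j"] assms(1-4) by simp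
  qed (use assms in auto)
qed

section \<open>Unitary matrices and unitary similarity\<close>

lemma unitary_mat_one: "unitary_mat n (1\<^sub>m n)"
  by (simp add: unitary_mat_def)

lemma unitary_mat_mult:
  assumes U: "unitary_mat n U" and V: "unitary_mat n V"
  shows "unitary_mat n (U * V)"
proof -
  note carr = U[unfolded unitary_mat_def, THEN conjunct1] V[unfolded unitary_mat_def, THEN conjunct1]
  have "mat_adjoint (U * V) * (U * V) = mat_adjoint V * ((mat_adjoint U * U) * V)"
    using carr by (simp add: mat_adjoint_mult[OF carr] assoc_mult_mat[of _ n n _ n _ n] mult_carrier_mat[of _ n n _ n])
  moreover have "(U * V) * mat_adjoint (U * V) = U * ((V * mat_adjoint V) * mat_adjoint U)"
    using carr by (simp add: mat_adjoint_mult[OF carr] assoc_mult_mat[of _ n n _ n _ n] mult_carrier_mat[of _ n n _ n])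
  ultimately show ?thesis
    using U V left_mult_one_mat[OF carr(2)] left_mult_one_mat[OF mat_adjoint_carrier[OF carr(1)]]
    by (simp add: unitary_mat_def mult_carrier_mat[of _ n n _ n])
qed

lemma unitary_mat_four_block_one:
  assumes W: "unitary_mat r W"
  shows "unitary_mat (r + s) (four_block_mat W (0\<^sub>m r s) (0\<^sub>m s r) (1\<^sub>m s))"
proof -
  have c: "W \<in> carrier_mat r r" using W by (simp add: unitary_mat_def)
  show ?thesis
    using W c unfolding unitary_mat_def
    by (simp add: mat_adjoint_four_block_mat[OF c zero_carrier_mat zero_carrier_mat one_carrier_mat]
        mult_four_block_mat[where ?nr1.0 = r and ?nr2.0 = s and ?n1.0 = r and ?n2.0 = s
          and ?nc1.0 = r and ?nc2.0 = s])
qed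

lemma unitary_mat_conj_carrier:
  assumes "unitary_mat n U" "B \<in> carrier_mat n n"
  shows "mat_adjoint U * B * U \<in> carrier_mat n n"
  using assms by (auto simp: unitary_mat_def intro!: mult_carrier_mat[of _ n n])

lemma unitary_mat_conj_cancel:
  assumes U: "unitary_mat n U" and B: "B \<in> carrier_mat n n"
  shows "U * (mat_adjoint U * B * U) * mat_adjoint U = B"
    and "mat_adjoint U * (U * B * mat_adjoint U) * U = B"
proof -
  have c: "U \<in> carrier_mat n n" and 1: "U * mat_adjoint U = 1\<^sub>m n" and 2: "mat_adjoint U * U = 1\<^sub>m n"
    using U by (auto simp: unitary_mat_def)
  have "U * (mat_adjoint U * B * U) * mat_adjoint U = (U * mat_adjoint U) * B * (U * mat_adjoint U)"
    using c B by (simp add: assoc_mult_mat[of _ n n _ n _ n] mult_carrier_mat[of _ n n _ n])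
  then show "U * (mat_adjoint U * B * U) * mat_adjoint U = B"
    using B by (simp add: 1)
  have "mat_adjoint U * (U * B * mat_adjoint U) * U = (mat_adjoint U * U) * B * (mat_adjoint U * U)"
    using c B by (simp add: assoc_mult_mat[of _ n n _ n _ n] mult_carrier_mat[of _ n n _ n])
  then show "mat_adjoint U * (U * B * mat_adjoint U) * U = B"
    using B by (simp add: 2)
qed

lemma unitary_mat_conj_mult:
  assumes U: "unitary_mat n U" and B: "B \<in> carrier_mat n n" and C: "C \<in> carrier_mat n n"
  shows "(mat_adjoint U * B * U) * (mat_adjoint U * C * U) = mat_adjoint U * (B * C) * U"
proof -
  have c: "U \<in> carrier_mat n n" and 1: "U * mat_adjoint U = 1\<^sub>m n"
    using U by (auto simp: unitary_mat_def)
  have "(mat_adjoint U * B * U) * (mat_adjoint U * C * U) =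
      mat_adjoint U * (B * ((U * mat_adjoint U) * (C * U)))"
    using c B C by (simp add: assoc_mult_mat[of _ n n _ n _ n] mult_carrier_mat[of _ n n _ n])
  also have "\<dots> = mat_adjoint U * (B * C) * U"
    using c B C unfolding 1 by (simp add: assoc_mult_mat[of _ n n _ n _ n] mult_carrier_mat[of _ n n _ n])
  finally show ?thesis .
qed

lemma unitary_mat_conj_pow:
  assumes U: "unitary_mat n U" and B: "B \<in> carrier_mat n n"
  shows "(mat_adjoint U * B * U) ^\<^sub>m k = mat_adjoint U * B ^\<^sub>m k * U"
proof (induction k)
  case 0
  then show ?case using U B by (auto simp: unitary_mat_def)
next
  case (Suc k)
  then show ?case using unitary_mat_conj_mult[OF U pow_carrier_mat[OF B] B] by simp
qed

section \<open>Unitary matrices with a prescribed column direction\<close>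

text \<open>Dividing each vector of an orthogonal list by its norm turns the Gram matrix of the
  columns into the identity. The scaling factors stay existential because only the directions of the
  columns matter later.\<close>

lemma unitary_mat_normalize_cols:
  fixes ws :: "complex vec list"
  assumes ws: "set ws \<subseteq> carrier_vec n" and orth: "corthogonal ws" and len: "length ws = n"
  shows "\<exists>c. unitary_mat n (mat n n (\<lambda>(i, j). c j * (ws ! j) $ i))"
proof -
  \<comment> \<open>The reciprocal of the norm of \<open>ws ! j\<close>; \<open>Re\<close> is
    harmless because \<open>pos\<close> shows this inner product to be real and positive.\<close>
  define c where "c = (\<lambda>j. complex_of_real (1 / sqrt (Re ((ws ! j) \<bullet>c (ws ! j)))))"
  define W where "W = mat n n (\<lambda>(i, j). c j * (ws ! j) $ i)"
  have W: "W \<in> carrier_mat n n" by (simp add: W_def)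
  have wc: "ws ! j \<in> carrier_vec n" if "j < n" for j
    using ws len that nth_mem by blast
  have pos: "\<exists>r>0. (ws ! j) \<bullet>c (ws ! j) = complex_of_real r" if j: "j < n" for j
  proof -
    have "(ws ! j) \<bullet>c (ws ! j) \<noteq> 0"
      using corthogonalD[OF orth, of j j] j len by auto
    \<comment> \<open>The order on the complex numbers compares only numbers with equal imaginary
      parts, so being above 0 includes being real.\<close>
    moreover have "(ws ! j) \<bullet>c (ws ! j) \<ge> 0" by (rule conjugate_square_ge_0_vec)
    ultimately show ?thesis
      by (intro exI[of _ "Re ((ws ! j) \<bullet>c (ws ! j))"])
        (auto simp: complex_eq_iff less_eq_complex_def less_le)
  qed
  have cc: "c j * c j * ((ws ! j) \<bullet>c (ws ! j)) = 1" if "j < n" for j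
  proof -
    from pos[OF that] obtain r where r: "r > 0" "(ws ! j) \<bullet>c (ws ! j) = complex_of_real r" by blast
    then show ?thesis by (simp add: c_def flip: of_real_mult)
  qed
  have "mat_adjoint W * W = 1\<^sub>m n"
  proof (rule eq_matI)
    fix i j assume "i < dim_row (1\<^sub>m n :: complex mat)" "j < dim_col (1\<^sub>m n :: complex mat)"
    then have i: "i < n" and j: "j < n" by auto
    \<comment> \<open>The factors \<open>c i\<close> are real, so the conjugation in the adjoint
      leaves them unchanged.\<close>
    have "(mat_adjoint W * W) $$ (i, j) =
        (\<Sum>k = 0..<n. c i * c j * ((ws ! j) $ k * conjugate ((ws ! i) $ k)))"
      using i j W by (auto simp: scalar_prod_def W_def c_def intro!: sum.cong)
    also have "\<dots> = c i * c j * ((ws ! j) \<bullet>c (ws ! i))"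
      using wc[OF i] wc[OF j] by (simp add: scalar_prod_def sum_distrib_left)
    also have "\<dots> = 1\<^sub>m n $$ (i, j)"
      using corthogonalD[OF orth, of j i] cc[OF i] i j len by auto
    finally show "(mat_adjoint W * W) $$ (i, j) = 1\<^sub>m n $$ (i, j)" .
  qed (use W in auto)
  moreover from this have "W * mat_adjoint W = 1\<^sub>m n"
    using mat_mult_left_right_inverse[OF mat_adjoint_carrier[OF W] W] by simp
  ultimately have "unitary_mat n W" using W by (simp add: unitary_mat_def)
  then show ?thesis unfolding W_def by blast
qed

text \<open>Complete \<open>v\<close> to a basis with \<open>v\<close> at its head. Gram-Schmidt
  keeps the first vector, and reversing the resulting list moves it to the last column, where the
  descent on \<open>r\<close> needs it.\<close>

lemma unitary_mat_exists_last_col: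
  fixes v :: "complex vec"
  assumes v: "v \<in> carrier_vec (Suc r)" and v0: "v \<noteq> 0\<^sub>v (Suc r)"
  shows "\<exists>W c. unitary_mat (Suc r) W \<and> col W r = c \<cdot>\<^sub>v v"
proof -
  interpret cof_vec_space "Suc r" "TYPE(complex)" .
  define ws where "ws = gram_schmidt (Suc r) (basis_completion v)"
  note b = basis_completion[OF v v0]
  note gs = gram_schmidt_result[OF b(2,4,5) ws_def]
  have len: "length ws = Suc r" using gs(4) b(6) by simp
  have "hd ws = v"
    using gram_schmidt_hd[OF v] by (simp add: ws_def basis_completion_def Let_def)
  then have ws0: "ws ! 0 = v" using len by (cases ws) auto
  have orth: "corthogonal (rev ws)"
  proof (rule corthogonalI)
    fix i j assume "i < length (rev ws)" "j < length (rev ws)"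
    then show "rev ws ! i \<bullet>c rev ws ! j = 0 \<longleftrightarrow> i \<noteq> j"
      using corthogonalD[OF gs(2), of "length ws - Suc i" "length ws - Suc j"]
      by (auto simp: rev_nth)
  qed
  obtain c where c: "unitary_mat (Suc r) (mat (Suc r) (Suc r) (\<lambda>(i, j). c j * (rev ws ! j) $ i))"
    using unitary_mat_normalize_cols[of "rev ws" "Suc r"] orth gs(3) len by auto
  have "col (mat (Suc r) (Suc r) (\<lambda>(i, j). c j * (rev ws ! j) $ i)) r = c r \<cdot>\<^sub>v v"
    using v len ws0 by (intro eq_vecI) (auto simp: rev_nth)
  then show ?thesis using c by blast
qed

section \<open>Column spaces and the factorization of a core-invertible matrix\<close>

text \<open>A maximal independent set of columns of \<open>B\<close> lies in the column space of
  \<open>A\<close> and has as many elements as that space has dimensions. It is therefore a basis of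
  it, while its span stays inside the column space of \<open>B\<close>.\<close>

lemma (in vec_space) col_space_eqI_rank:
  assumes A: "A \<in> carrier_mat n p" and B: "B \<in> carrier_mat n q"
    and sub: "col_space B \<subseteq> col_space A" and rank: "rank B = rank A"
  shows "col_space B = col_space A"
proof -
  have cA: "set (cols A) \<subseteq> carrier_vec n" and cB: "set (cols B) \<subseteq> carrier_vec n"
    using A B cols_dim by blast+
  define W where "W = span (set (cols A))"
  have sm: "submodule class_ring W V"
    unfolding W_def using span_is_submodule cA by simp
  \<comment> \<open>The column space of \<open>A\<close> becomes a vector space in its own right, so
    that the dimension criterion for bases applies inside it.\<close>
  interpret W: vectorspace class_ring "vs W"
    using span_is_subspace[of "set (cols A)"] cA subspace_is_vs W_def by auto
  obtain S where S: "maximal S (\<lambda>T. T \<subseteq> set (cols B) \<and> lin_indpt T)" "finite S"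
    using maximal_exists_superset[of "set (cols B)" "\<lambda>T. T \<subseteq> set (cols B) \<and> lin_indpt T" "{}"]
    by (auto simp: maximal_def lin_dep_def intro: finite_subset)
  then have SB: "S \<subseteq> set (cols B)" and li: "lin_indpt S" by (auto simp: maximal_def)
  have SW: "S \<subseteq> W"
    using SB sub in_own_span[OF cB] unfolding col_space_def W_def by auto
  have "W.basis S"
  proof (rule W.dim_li_is_basis)
    show "W.fin_dim" unfolding W_def using fin_dim_span_cols[OF A] by simp
    show "finite S" by fact
    show "S \<subseteq> carrier (vs W)" using SW by simp
    show "W.lin_indpt S" using span_li_not_depend(2)[OF SW sm] li by simp
    show "W.dim \<le> card S"
      using rank_card_indpt[OF B S(1)] rank by (simp add: rank_def W_def)
  qed
  then have "span S = W"
    using span_li_not_depend(1)[OF SW sm] by (simp add: W.basis_def)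
  moreover have "span S \<subseteq> col_space B"
    using span_is_monotone[OF SB] by (simp add: col_space_def)
  ultimately show ?thesis using sub by (auto simp: col_space_def W_def)
qed

text \<open>The column space of \<open>A * A\<close> always lies in that of \<open>A\<close>, and
  equal ranks make the two coincide. So every column of \<open>A\<close> is the image under
  \<open>A * A\<close> of some vector; these vectors are the columns of \<open>X\<close>.\<close>

lemma core_invertible_factor:
  assumes "A \<in> core_invertible_mats n"
  shows "\<exists>X \<in> carrier_mat n n. A = A * A * X"
proof -
  interpret vec_space "TYPE(complex)" n .
  have A: "A \<in> carrier_mat n n" and rk: "rank (A * A) = rank A"
    using assms by (auto simp: core_invertible_mats_def numeral_2_eq_2)
  have AA: "A * A \<in> carrier_mat n n" using A by simp
  have "col_space (A * A) \<subseteq> col_space A"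
    unfolding col_space_eq[OF A] col_space_eq[OF AA] using A
    by (auto simp: assoc_mult_mat_vec[of _ n n _ n] intro!: bexI[of _ "A *\<^sub>v _"])
  then have eq: "col_space (A * A) = col_space A"
    using col_space_eqI_rank[OF A AA] rk by simp
  have "\<exists>x \<in> carrier_vec n. A * A *\<^sub>v x = col A j" if "j < n" for j
  proof -
    have "col A j \<in> set (cols A)" using A that by (auto simp: cols_def)
    then have "col A j \<in> col_space A"
      unfolding col_space_def using in_own_span[of "set (cols A)"] cols_dim[of A] A by auto
    then show ?thesis unfolding eq[symmetric] col_space_eq[OF AA] using A by auto
  qed
  then obtain x where x: "\<And>j. j < n \<Longrightarrow> x j \<in> carrier_vec n \<and> A * A *\<^sub>v x j = col A j" by metis
  define X where "X = mat_of_cols n (map x [0..<n])"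
  have X: "X \<in> carrier_mat n n" unfolding X_def by (simp add: mat_of_cols_carrier(1)[of n "map x [0..<n]", simplified])
  have "A * A * X = A"
  proof (rule mat_col_eqI)
    fix j assume "j < dim_col A"
    then have j: "j < n" using A by simp
    have "col X j = x j" unfolding X_def using j x by (subst col_mat_of_cols) auto
    then show "col (A * A * X) j = col A j"
      using col_mult2[OF AA X j] x[OF j] by simp
  qed (use A X in auto)
  then show ?thesis using X by metis
qed

section \<open>Unitary block form of a core-invertible matrix\<close>

text \<open>The descent step: a singular leading block of size \<open>Suc r\<close> allows a further
  unitary rotation after which row \<open>r\<close> vanishes as well.\<close>

lemma core_form_singular_step:
  assumes A: "A \<in> carrier_mat (Suc r + s) (Suc r + s)"
    and X: "X \<in> carrier_mat (Suc r + s) (Suc r + s)" and AX: "A = A * A * X"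
    and U: "unitary_mat (Suc r + s) U"
    and T: "T \<in> carrier_mat (Suc r) (Suc r)" and S: "S \<in> carrier_mat (Suc r) s"
    and F: "mat_adjoint U * A * U = four_block_mat T S (0\<^sub>m s (Suc r)) (0\<^sub>m s s)"
    and sing: "det T = 0"
  shows "\<exists>V. unitary_mat (Suc r + s) V \<and>
    (\<forall>i j. r \<le> i \<longrightarrow> i < Suc r + s \<longrightarrow> j < Suc r + s \<longrightarrow> (mat_adjoint V * A * V) $$ (i, j) = 0)"
proof -
  let ?n = "Suc r + s"
  define F where "F = four_block_mat T S (0\<^sub>m s (Suc r)) (0\<^sub>m s s)"
  define Y where "Y = mat_adjoint U * X * U"
  have cU: "U \<in> carrier_mat ?n ?n" using U by (simp add: unitary_mat_def)
  have cF: "F \<in> carrier_mat ?n ?n" unfolding F_def by (rule four_block_carrier_mat[OF T zero_carrier_mat])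
  have cY: "Y \<in> carrier_mat ?n ?n" unfolding Y_def by (rule unitary_mat_conj_carrier[OF U X])
  have FY: "F = F * F * Y"
    using unitary_mat_conj_mult[OF U A A] unitary_mat_conj_mult[OF U mult_carrier_mat[OF A A] X]
      AX F by (simp add: F_def Y_def)
  \<comment> \<open>The left null vector of \<open>T\<close> is encoded as a null vector of the
    transpose, without conjugation.\<close>
  obtain v where v: "v \<in> carrier_vec (Suc r)" "v \<noteq> 0\<^sub>v (Suc r)" and Tv: "T\<^sup>T *\<^sub>v v = 0\<^sub>v (Suc r)"
    using det_0_iff_vec_prod_zero_field[of "T\<^sup>T" "Suc r"] T sing by (auto simp: det_transpose[OF T])
  have Ft: "F\<^sup>T = four_block_mat T\<^sup>T (0\<^sub>m (Suc r) s) S\<^sup>T (0\<^sub>m s s)"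
    unfolding F_def by (simp add: transpose_four_block_mat[OF T S zero_carrier_mat zero_carrier_mat])
  have Ft_append: "F\<^sup>T *\<^sub>v (a @\<^sub>v b) = (T\<^sup>T *\<^sub>v a) @\<^sub>v (S\<^sup>T *\<^sub>v a)"
    if a: "a \<in> carrier_vec (Suc r)" and b: "b \<in> carrier_vec s" for a b
    unfolding Ft using T S a b
    by (subst four_block_mat_mult_vec[of _ "Suc r" "Suc r" _ s _ s]) auto
  \<comment> \<open>Transposing \<open>FY\<close> shows that the square of \<open>F\<^sup>T\<close>
    has no larger kernel than \<open>F\<^sup>T\<close> itself. Padding \<open>v\<close> with zeros
    gives a vector that \<open>F\<^sup>T\<close> sends into the last \<open>s\<close> coordinates,
    which a second application kills; hence one application already kills it.\<close>
  have Sv: "S\<^sup>T *\<^sub>v v = 0\<^sub>v s"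
  proof -
    let ?w = "v @\<^sub>v 0\<^sub>v s"
    have w: "?w \<in> carrier_vec ?n"
      by (rule append_carrier_vec[OF v(1) zero_carrier_vec])
    have "F\<^sup>T *\<^sub>v (F\<^sup>T *\<^sub>v ?w) = F\<^sup>T *\<^sub>v (0\<^sub>v (Suc r) @\<^sub>v (S\<^sup>T *\<^sub>v v))"
      using v Tv by (simp add: Ft_append)
    also have "\<dots> = (T\<^sup>T *\<^sub>v 0\<^sub>v (Suc r)) @\<^sub>v (S\<^sup>T *\<^sub>v 0\<^sub>v (Suc r))"
      using S v by (intro Ft_append) auto
    also have "\<dots> = 0\<^sub>v ?n"
      using T S by (intro eq_vecI) (auto simp: scalar_prod_def)
    finally have FFw: "F\<^sup>T *\<^sub>v (F\<^sup>T *\<^sub>v ?w) = 0\<^sub>v ?n" .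
    have cFt: "F\<^sup>T \<in> carrier_mat ?n ?n" and cYt: "Y\<^sup>T \<in> carrier_mat ?n ?n"
      using cF cY by (auto simp only: transpose_carrier_mat)
    have "F\<^sup>T = Y\<^sup>T * (F\<^sup>T * F\<^sup>T)"
      using arg_cong[OF FY, of transpose_mat]
      unfolding transpose_mult[OF mult_carrier_mat[OF cF cF] cY] transpose_mult[OF cF cF] .
    then have "F\<^sup>T *\<^sub>v ?w = Y\<^sup>T * (F\<^sup>T * F\<^sup>T) *\<^sub>v ?w" by simp
    also have "\<dots> = Y\<^sup>T *\<^sub>v (F\<^sup>T *\<^sub>v (F\<^sup>T *\<^sub>v ?w))"
      using assoc_mult_mat_vec[OF cYt mult_carrier_mat[OF cFt cFt] w]
        assoc_mult_mat_vec[OF cFt cFt w] by simp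
    also have "\<dots> = 0\<^sub>v ?n" unfolding FFw using cY by (intro eq_vecI) auto
    finally have Fw: "(T\<^sup>T *\<^sub>v v) @\<^sub>v (S\<^sup>T *\<^sub>v v) = 0\<^sub>v ?n" using Ft_append[OF v(1), of "0\<^sub>v s"] by simp
    show ?thesis
    proof (rule eq_vecI)
      fix i assume i: "i < dim_vec (0\<^sub>v s :: complex vec)"
      have "((T\<^sup>T *\<^sub>v v) @\<^sub>v (S\<^sup>T *\<^sub>v v)) $ (Suc r + i) = (S\<^sup>T *\<^sub>v v) $ i"
        using i T S by (subst index_append_vec) auto
      then show "(S\<^sup>T *\<^sub>v v) $ i = 0\<^sub>v s $ i" using i by (simp add: Fw)
    qed (use S in simp)
  qed
  \<comment> \<open>The column is taken along \<open>conjugate v\<close> so that the corresponding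
    row of \<open>mat_adjoint W\<close> is a multiple of \<open>v\<close> itself.\<close>
  obtain W c where W: "unitary_mat (Suc r) W" and Wr: "col W r = c \<cdot>\<^sub>v conjugate v"
    using unitary_mat_exists_last_col[of "conjugate v" r] v by auto
  have cW: "W \<in> carrier_mat (Suc r) (Suc r)" using W by (simp add: unitary_mat_def)
  have rW: "row (mat_adjoint W) r = conjugate c \<cdot>\<^sub>v v"
  proof (rule eq_vecI)
    fix i assume "i < dim_vec (conjugate c \<cdot>\<^sub>v v)"
    then have i: "i < Suc r" using v by simp
    have "W $$ (i, r) = col W r $ i" using i cW by simp
    also have "\<dots> = c * conjugate (v $ i)" using i v unfolding Wr by simp
    finally show "row (mat_adjoint W) r $ i = (conjugate c \<cdot>\<^sub>v v) $ i"
      using i v cW by (simp add: conjugate_dist_mul)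
  qed (use v cW in simp)
  \<comment> \<open>Row \<open>r\<close> of the product is a multiple of the row vector
    \<open>v\<close> times \<open>M\<close>; this will be applied to both \<open>T\<close> and
    \<open>S\<close>.\<close>
  have row0: "row (mat_adjoint W * M) r = 0\<^sub>v k"
    if M: "M \<in> carrier_mat (Suc r) k" and Mv: "M\<^sup>T *\<^sub>v v = 0\<^sub>v k" for M k
  proof (rule eq_vecI)
    fix j assume "j < dim_vec (0\<^sub>v k :: complex vec)"
    then have j: "j < k" by simp
    have "row (mat_adjoint W * M) r $ j = conjugate c * (v \<bullet> col M j)"
      using cW M j v by (simp add: rW)
    also have "v \<bullet> col M j = (M\<^sup>T *\<^sub>v v) $ j"
      using M j v by (simp add: comm_scalar_prod[of _ "Suc r"])
    finally show "row (mat_adjoint W * M) r $ j = 0\<^sub>v k $ j" using Mv j by simp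
  qed (use M in simp)
  \<comment> \<open>Rotating only the first \<open>Suc r\<close> coordinates keeps the last
    \<open>s\<close> rows zero.\<close>
  define D where "D = four_block_mat W (0\<^sub>m (Suc r) s) (0\<^sub>m s (Suc r)) (1\<^sub>m s)"
  have D: "unitary_mat ?n D" unfolding D_def by (rule unitary_mat_four_block_one[OF W])
  have cD: "D \<in> carrier_mat ?n ?n" using D by (simp add: unitary_mat_def)
  note cWT = mult_carrier_mat[OF mat_adjoint_carrier[OF cW] T]
  note cWS = mult_carrier_mat[OF mat_adjoint_carrier[OF cW] S]
  let ?V = "U * D"
  have "mat_adjoint ?V * A * ?V = mat_adjoint D * (mat_adjoint U * A * U) * D"
    by (rule mat_adjoint_mult_conj[OF cU cD A])
  also have "\<dots> = four_block_mat (mat_adjoint W * T * W) (mat_adjoint W * S) (0\<^sub>m s (Suc r)) (0\<^sub>m s s)"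
    unfolding F unfolding D_def using cW T S
    by (simp add: mat_adjoint_four_block_mat[OF cW zero_carrier_mat zero_carrier_mat one_carrier_mat]
        mult_four_block_mat[where ?nr1.0 = "Suc r" and ?nr2.0 = s and ?n1.0 = "Suc r" and ?n2.0 = s
          and ?nc1.0 = "Suc r" and ?nc2.0 = s]
        cWT cWS right_add_zero_mat[OF cWT] right_add_zero_mat[OF cWS]
        right_add_zero_mat[OF mult_carrier_mat[OF cWT cW]])
  finally have V: "mat_adjoint ?V * A * ?V =
      four_block_mat (mat_adjoint W * T * W) (mat_adjoint W * S) (0\<^sub>m s (Suc r)) (0\<^sub>m s s)" .
  \<comment> \<open>Row \<open>r\<close> already vanishes in \<open>mat_adjoint W * T\<close>, and
    right multiplication by \<open>W\<close> preserves this.\<close>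
  have "(mat_adjoint W * T * W) $$ (r, j) = 0" if "j < Suc r" for j
    using row0[OF T Tv] cW T that by simp
  moreover have "(mat_adjoint W * S) $$ (r, j) = 0" if "j < s" for j
    using arg_cong[OF row0[OF S Sv], of "\<lambda>u. u $ j"] cW S that by simp
  ultimately have "(mat_adjoint ?V * A * ?V) $$ (i, j) = 0" if "r \<le> i" "i < ?n" "j < ?n" for i j
    unfolding V using that cW T S by (cases "i = r") auto
  then show ?thesis using unitary_mat_mult[OF U D] by blast
qed

text \<open>Minimality of \<open>r\<close> rules out a singular leading block, since
  \<open>core_form_singular_step\<close> would then lower \<open>r\<close> by one.\<close>

lemma core_invertible_unitary_form:
  assumes "A \<in> core_invertible_mats n"
  shows "\<exists>U r s T S. unitary_mat n U \<and> r + s = n \<and> T \<in> carrier_mat r r \<and> S \<in> carrier_mat r s \<and>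
    invertible_mat T \<and> A = U * four_block_mat T S (0\<^sub>m s r) (0\<^sub>m s s) * mat_adjoint U"
proof -
  have A: "A \<in> carrier_mat n n" using assms by (simp add: core_invertible_mats_def)
  obtain X where X: "X \<in> carrier_mat n n" and AX: "A = A * A * X"
    using core_invertible_factor[OF assms] by blast
  define P where "P = (\<lambda>r. \<exists>U. unitary_mat n U \<and>
    (\<forall>i j. r \<le> i \<longrightarrow> i < n \<longrightarrow> j < n \<longrightarrow> (mat_adjoint U * A * U) $$ (i, j) = 0))"
  define r where "r = (LEAST r. P r)"
  \<comment> \<open>For \<open>r = n\<close> no row is required to vanish, so the minimum
    exists.\<close>
  have Pn: "P n" using unitary_mat_one by (auto simp: P_def)
  have "P r" unfolding r_def by (rule LeastI[of P, OF Pn])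
  have least: "\<not> P q" if "q < r" for q using not_less_Least that unfolding r_def by blast
  have "r \<le> n" unfolding r_def by (rule Least_le[of P, OF Pn])
  then obtain s where s: "r + s = n" using le_Suc_ex by metis
  from \<open>P r\<close> obtain U where U: "unitary_mat n U"
    and zero: "\<And>i j. r \<le> i \<Longrightarrow> i < n \<Longrightarrow> j < n \<Longrightarrow> (mat_adjoint U * A * U) $$ (i, j) = 0"
    by (auto simp: P_def)
  have cU: "U \<in> carrier_mat n n" using U by (simp add: unitary_mat_def)
  define F where "F = mat_adjoint U * A * U"
  have cF: "F \<in> carrier_mat n n" unfolding F_def by (rule unitary_mat_conj_carrier[OF U A])
  define T where "T = mat r r (\<lambda>(i, j). F $$ (i, j))"
  define S where "S = mat r s (\<lambda>(i, j). F $$ (i, r + j))"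
  have T: "T \<in> carrier_mat r r" and S: "S \<in> carrier_mat r s" by (auto simp: T_def S_def)
  have F: "F = four_block_mat T S (0\<^sub>m s r) (0\<^sub>m s s)"
    using cF s zero[folded F_def] by (intro eq_matI) (auto simp: T_def S_def)
  have "det T \<noteq> 0"
  proof
    assume sing: "det T = 0"
    show False
    proof (cases r)
      case 0
      \<comment> \<open>The empty matrix has determinant 1, so an empty leading block counts as
        non-singular.\<close>
      then show ?thesis using sing T by (simp add: det_dim_zero)
    next
      case (Suc q)
      then have "P q"
        using core_form_singular_step[of A q s X U T S] A X AX U T S F s sing
        by (auto simp: P_def F_def)
      then show ?thesis using least[of q] Suc by simp
    qed
  qed
  then have "invertible_mat T"
    using det_non_zero_imp_unit[OF T, of "()"] T
    by (auto simp: Units_def ring_mat_def invertible_mat_def inverts_mat_def square_mat.simps)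
  moreover have "A = U * four_block_mat T S (0\<^sub>m s r) (0\<^sub>m s s) * mat_adjoint U"
    using unitary_mat_conj_cancel(1)[OF U A] F by (simp add: F_def)
  ultimately show ?thesis using U s T S by blast
qed

section \<open>Block form of both summands of the core-EP decomposition\<close>

theorem theorem2p3:
  fixes A A1 A2 :: "complex mat" and n :: nat
  assumes "A \<in> carrier_mat n n"
    and "core_EP_decomposition n A A1 A2"
  shows "\<exists>U r s T S N.
           unitary_mat n U \<and> r + s = n \<and>
           T \<in> carrier_mat r r \<and> S \<in> carrier_mat r s \<and> N \<in> carrier_mat s s \<and>
           invertible_mat T \<and> nilpotent_mat N \<and>
           A1 = U * four_block_mat T S (0\<^sub>m s r) (0\<^sub>m s s) * mat_adjoint U \<and>
           A2 = U * four_block_mat (0\<^sub>m r r) (0\<^sub>m r s) (0\<^sub>m s r) N * mat_adjoint U"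
proof -
  have A1: "A1 \<in> carrier_mat n n" and A2: "A2 \<in> carrier_mat n n"
    and core: "A1 \<in> core_invertible_mats n"
    and A12: "mat_adjoint A1 * A2 = 0\<^sub>m n n" and A21: "A2 * A1 = 0\<^sub>m n n"
    and ind: "if mat_Ind n A = 0 then A2 = 0\<^sub>m n n else A2 ^\<^sub>m mat_Ind n A = 0\<^sub>m n n"
    using assms by (auto simp: core_EP_decomposition_def)
  \<comment> \<open>A positive exponent in both cases: for index 0 the matrix \<open>A2\<close> is
    zero and the exponent 1 serves.\<close>
  obtain m where m: "m > 0" "A2 ^\<^sub>m m = 0\<^sub>m n n"
  proof (cases "mat_Ind n A = 0")
    case True
    then show ?thesis using ind that[of 1] by simp
  next
    case False
    then show ?thesis using ind that by simp
  qed
  obtain U r s T S where U: "unitary_mat n U" and n: "r + s = n"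
    and T: "T \<in> carrier_mat r r" and S: "S \<in> carrier_mat r s" and inv: "invertible_mat T"
    and A1U: "A1 = U * four_block_mat T S (0\<^sub>m s r) (0\<^sub>m s s) * mat_adjoint U"
    using core_invertible_unitary_form[OF core] by blast
  have cU: "U \<in> carrier_mat n n" using U by (simp add: unitary_mat_def)
  define F where "F = four_block_mat T S (0\<^sub>m s r) (0\<^sub>m s s)"
  define G where "G = mat_adjoint U * A2 * U"
  have cF: "F \<in> carrier_mat n n" using T n unfolding F_def by (metis four_block_carrier_mat zero_carrier_mat)
  have cG: "G \<in> carrier_mat n n" unfolding G_def by (rule unitary_mat_conj_carrier[OF U A2])
  have FA: "F = mat_adjoint U * A1 * U"
    unfolding A1U using unitary_mat_conj_cancel(2)[OF U cF] by (simp add: F_def)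
  have F_adj: "mat_adjoint F = mat_adjoint U * mat_adjoint A1 * U"
    unfolding FA using cU A1
    by (simp add: mat_adjoint_mult[of _ n n _ n] assoc_mult_mat[of _ n n _ n _ n]
        mult_carrier_mat[of _ n n _ n])
  have FG: "mat_adjoint F * G = 0\<^sub>m n n"
    unfolding F_adj G_def unitary_mat_conj_mult[OF U mat_adjoint_carrier[OF A1] A2] A12
    using cU by simp
  have GF: "G * F = 0\<^sub>m n n"
    unfolding FA G_def unitary_mat_conj_mult[OF U A2 A1] A21 using cU by simp
  obtain B C E N where sp: "split_block G r r = (B, C, E, N)" by (metis prod_cases4)
  have dG: "dim_row G = r + s" "dim_col G = r + s" using cG n by auto
  note blocks = split_block[OF sp dG]
  obtain Ti where Ti: "T * Ti = 1\<^sub>m r" and "Ti * T = 1\<^sub>m (dim_row Ti)"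
    using inv T by (auto simp: invertible_mat_def inverts_mat_def)
  \<comment> \<open>The size of the inverse is not part of \<open>invertible_mat\<close>; comparing
    the numbers of columns in the two inverse equations fixes it.\<close>
  then have cTi: "Ti \<in> carrier_mat r r"
    using T by (metis carrier_matD(2) carrier_matI index_mult_mat(3) index_one_mat(3))
  have "mat_adjoint F * G = four_block_mat (mat_adjoint T * B) (mat_adjoint T * C)
      (mat_adjoint S * B) (mat_adjoint S * C)"
    unfolding F_def blocks(5)
    using mult_four_block_mat[OF mat_adjoint_carrier[OF T] zero_carrier_mat
        mat_adjoint_carrier[OF S] zero_carrier_mat blocks(1-4)]
    by (simp add: mat_adjoint_four_block_mat[OF T S zero_carrier_mat zero_carrier_mat]
        left_mult_zero_mat[OF blocks(3)] left_mult_zero_mat[OF blocks(4)]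
        mult_carrier_mat[OF mat_adjoint_carrier[OF T] blocks(1)]
        mult_carrier_mat[OF mat_adjoint_carrier[OF T] blocks(2)]
        mult_carrier_mat[OF mat_adjoint_carrier[OF S] blocks(1)]
        mult_carrier_mat[OF mat_adjoint_carrier[OF S] blocks(2)]
        right_add_zero_mat[of _ r r] right_add_zero_mat[of _ r s]
        right_add_zero_mat[of _ s r] right_add_zero_mat[of _ s s])
  then have "four_block_mat (mat_adjoint T * B) (mat_adjoint T * C)
      (mat_adjoint S * B) (mat_adjoint S * C) = 0\<^sub>m (r + s) (r + s)"
    using FG n by simp
  \<comment> \<open>The relation \<open>mat_adjoint A1 * A2 = 0\<close> controls the upper blocks
    \<open>B\<close> and \<open>C\<close> of \<open>G\<close>, through its upper block row.\<close>
  from four_block_mat_eq_zeroD(1,2)[OF _ _ _ _ this]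
  have TB: "mat_adjoint T * B = 0\<^sub>m r r" and TC: "mat_adjoint T * C = 0\<^sub>m r s"
    using T S blocks by (auto intro: mult_carrier_mat mat_adjoint_carrier)
  \<comment> \<open>The adjoint of the right inverse \<open>Ti\<close> is a left inverse of
    \<open>mat_adjoint T\<close>.\<close>
  have T_adj_cancel: "M = 0\<^sub>m r k" if "M \<in> carrier_mat r k" "mat_adjoint T * M = 0\<^sub>m r k" for M k
  proof -
    have "mat_adjoint Ti * (mat_adjoint T * M) = mat_adjoint (T * Ti) * M"
      using T cTi that(1) by (simp add: mat_adjoint_mult[OF T cTi] assoc_mult_mat[of _ r r _ r _ k])
    then show ?thesis using that cTi by (simp add: Ti right_mult_zero_mat[of _ r r])
  qed
  have B: "B = 0\<^sub>m r r" and C: "C = 0\<^sub>m r s"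
    using T_adj_cancel blocks(1,2) TB TC by auto
  have "G * F = four_block_mat (0\<^sub>m r r) (0\<^sub>m r s) (E * T) (E * S)"
    unfolding F_def blocks(5) B C
    using mult_four_block_mat[OF zero_carrier_mat zero_carrier_mat blocks(3,4) T S
        zero_carrier_mat zero_carrier_mat, of r]
    by (simp add: left_mult_zero_mat[OF T] left_mult_zero_mat[OF S]
        right_mult_zero_mat[OF blocks(4)]
        mult_carrier_mat[OF blocks(3) T] mult_carrier_mat[OF blocks(3) S]
        right_add_zero_mat[of _ s r] right_add_zero_mat[of _ s s])
  then have "four_block_mat (0\<^sub>m r r) (0\<^sub>m r s) (E * T) (E * S) = 0\<^sub>m (r + s) (r + s)"
    using GF n by simp
  \<comment> \<open>The relation \<open>A2 * A1 = 0\<close> controls the lower left block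
    \<open>E\<close>, from which \<open>T\<close> is cancelled on the right by
    \<open>Ti\<close>.\<close>
  from four_block_mat_eq_zeroD(3)[OF _ _ _ _ this]
  have "E * T = 0\<^sub>m s r" using T S blocks by (auto intro: mult_carrier_mat)
  then have "E * (T * Ti) = 0\<^sub>m s r"
    using assoc_mult_mat[OF blocks(3) T cTi] left_mult_zero_mat[OF cTi] by simp
  then have E: "E = 0\<^sub>m s r" using right_mult_one_mat[OF blocks(3)] by (simp add: Ti)
  have G: "G = four_block_mat (0\<^sub>m r r) (0\<^sub>m r s) (0\<^sub>m s r) N"
    unfolding blocks(5) B C E ..
  \<comment> \<open>Unitary similarity commutes with powers, and the powers of the block diagonal
    \<open>G\<close> are taken blockwise, so nilpotency passes from \<open>A2\<close> to
    \<open>N\<close>.\<close>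
  have "G ^\<^sub>m m = 0\<^sub>m n n"
    unfolding G_def unitary_mat_conj_pow[OF U A2] m(2) using cU by simp
  then have "four_block_mat (0\<^sub>m r r ^\<^sub>m m) (0\<^sub>m r s) (0\<^sub>m s r) (N ^\<^sub>m m) = 0\<^sub>m (r + s) (r + s)"
    unfolding G pow_four_block_mat[OF zero_carrier_mat blocks(4)] n .
  from four_block_mat_eq_zeroD(4)[OF _ _ _ _ this]
  have "N ^\<^sub>m m = 0\<^sub>m s s" using blocks(4) by simp
  then have "nilpotent_mat N"
    using m(1) blocks(4) by (auto simp: nilpotent_mat_def square_mat.simps)
  moreover have "A2 = U * four_block_mat (0\<^sub>m r r) (0\<^sub>m r s) (0\<^sub>m s r) N * mat_adjoint U"
    using unitary_mat_conj_cancel(1)[OF U A2] by (simp add: G_def flip: G)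
  ultimately show ?thesis using U n T S blocks(4) inv A1U by blast
qed

end
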